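(* Let $M\subset\mathbb{Q}$ and $f,g\colon M\to\mathbb{R}$ be functions such that (i) $f$ and $g$ are bounded, (ii) one of $f,g$ is uniformly continuous and the other has bounded derivative (on its domain of differentiability), and (iii) $f'$ is uniform on $D(f)$ and $g'$ is uniform on $D(g)$. Then $D(f)\cap D(g)\subset D(fg)$, and on $D(f)\cap D(g)$ the derivative of $fg$ equals $f'g+fg'$ and is uniform on $D(f)\cap D(g)$.
   Context: $fg$ is the pointwise product. A function $h\colon M\to\mathbb{R}$ is uniformly continuous if for every $k\in\mathbb{N}$ there is $l$ with $a,b\in M$, $|a-b|\le1/l\Rightarrow|h(a)-h(b)|\le1/k$. A rational $a\in M$ is a limit point of $M$ if for every $k$ there is $b\in M$ with $0<|a-b|\le1/k$. For such $a$, $h'(a)=y\in\mathbb{R}$ if for every $k$ there is $l$ with $b\in M$, $0<|a-b|\le1/l\Rightarrow|\frac{h(b)-h(a)}{b-a}-y|\le1/k$. $D(h)$ is the set of limit points $a\in M$ of $M$ where $h'(a)$ exists. The derivative of $h$ is uniform on a set $N\subset D(h)$ if for every $k$ there is $l$ such that for all $a\in N$ and $b\in M$ with $0<|a-b|\le1/l$: $|\frac{h(b)-h(a)}{b-a}-h'(a)|\le1/k$. *)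

theory Defs
  imports "HOL-Analysis.Analysis"
begin

text \<open>
  A function \<open>h : M \<rightarrow> \<real>\<close> with \<open>M \<subseteq> \<rat>\<close> is a total function \<open>h :: rat \<Rightarrow> real\<close>
  together with \<open>M\<close>; only the values of \<open>h\<close> on \<open>M\<close> enter the definitions below.
  The libraries provide no topology on \<^typ>\<open>rat\<close>, hence the explicit definitions.
  Indices \<open>k\<close>, \<open>l\<close> with \<open>1 / k\<close>, \<open>1 / l\<close> range over the positive naturals, since \<open>1 / 0 = 0\<close> in HOL.
\<close>

definition unif_cont_on :: "rat set \<Rightarrow> (rat \<Rightarrow> real) \<Rightarrow> bool" where
  "unif_cont_on M h \<longleftrightarrow>
    (\<forall>k::nat. k > 0 \<longrightarrow> (\<exists>l::nat. l > 0 \<and>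
      (\<forall>a\<in>M. \<forall>b\<in>M. \<bar>a - b\<bar> \<le> 1 / of_nat l \<longrightarrow> \<bar>h a - h b\<bar> \<le> 1 / real k)))"

definition limit_point :: "rat set \<Rightarrow> rat \<Rightarrow> bool" where
  "limit_point M a \<longleftrightarrow>
    (\<forall>k::nat. k > 0 \<longrightarrow> (\<exists>b\<in>M. 0 < \<bar>a - b\<bar> \<and> \<bar>a - b\<bar> \<le> 1 / of_nat k))"

definition diff_quot :: "(rat \<Rightarrow> real) \<Rightarrow> rat \<Rightarrow> rat \<Rightarrow> real" where
  "diff_quot h a b = (h b - h a) / of_rat (b - a)"

definition has_deriv_at :: "rat set \<Rightarrow> (rat \<Rightarrow> real) \<Rightarrow> rat \<Rightarrow> real \<Rightarrow> bool" where
  "has_deriv_at M h a y \<longleftrightarrow> a \<in> M \<and> limit_point M a \<and>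
    (\<forall>k::nat. k > 0 \<longrightarrow> (\<exists>l::nat. l > 0 \<and>
      (\<forall>b\<in>M. 0 < \<bar>a - b\<bar> \<and> \<bar>a - b\<bar> \<le> 1 / of_nat l \<longrightarrow> \<bar>diff_quot h a b - y\<bar> \<le> 1 / real k)))"

definition diff_dom :: "rat set \<Rightarrow> (rat \<Rightarrow> real) \<Rightarrow> rat set" where
  "diff_dom M h = {a. \<exists>y. has_deriv_at M h a y}"

text \<open>Meaningful on \<open>diff_dom M h\<close> only, where the value is unique (\<open>has_deriv_at_unique\<close> below).\<close>

definition derivative :: "rat set \<Rightarrow> (rat \<Rightarrow> real) \<Rightarrow> rat \<Rightarrow> real" where
  "derivative M h a = (THE y. has_deriv_at M h a y)"

definition uniform_derivative_on :: "rat set \<Rightarrow> (rat \<Rightarrow> real) \<Rightarrow> rat set \<Rightarrow> bool" where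
  "uniform_derivative_on M h N \<longleftrightarrow> N \<subseteq> diff_dom M h \<and>
    (\<forall>k::nat. k > 0 \<longrightarrow> (\<exists>l::nat. l > 0 \<and>
      (\<forall>a\<in>N. \<forall>b\<in>M. 0 < \<bar>a - b\<bar> \<and> \<bar>a - b\<bar> \<le> 1 / of_nat l \<longrightarrow>
        \<bar>diff_quot h a b - derivative M h a\<bar> \<le> 1 / real k)))"

lemma has_deriv_at_unique:
  assumes "has_deriv_at M h a y" and "has_deriv_at M h a z"
  shows "y = z"
proof (rule ccontr)
  assume "y \<noteq> z"
  then obtain n where n: "inverse (real (Suc n)) < \<bar>y - z\<bar> / 2"
    using reals_Archimedean[of "\<bar>y - z\<bar> / 2"] by auto
  obtain l where l: "l > 0" "\<forall>b\<in>M. 0 < \<bar>a - b\<bar> \<and> \<bar>a - b\<bar> \<le> 1 / of_nat l \<longrightarrow>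
      \<bar>diff_quot h a b - y\<bar> \<le> 1 / real (Suc n)"
    using assms(1) unfolding has_deriv_at_def by (meson zero_less_Suc)
  obtain m where m: "m > 0" "\<forall>b\<in>M. 0 < \<bar>a - b\<bar> \<and> \<bar>a - b\<bar> \<le> 1 / of_nat m \<longrightarrow>
      \<bar>diff_quot h a b - z\<bar> \<le> 1 / real (Suc n)"
    using assms(2) unfolding has_deriv_at_def by (meson zero_less_Suc)
  obtain b where b: "b \<in> M" "0 < \<bar>a - b\<bar>" "\<bar>a - b\<bar> \<le> 1 / of_nat (max l m)"
    using assms(1) l(1) unfolding has_deriv_at_def limit_point_def
    by (meson less_max_iff_disj)
  have "1 / of_nat (max l m) \<le> (1 / of_nat l :: rat)" "1 / of_nat (max l m) \<le> (1 / of_nat m :: rat)"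
    using l(1) m(1) by (auto intro!: divide_left_mono simp del: of_nat_max)
  then have "\<bar>a - b\<bar> \<le> 1 / of_nat l" "\<bar>a - b\<bar> \<le> 1 / of_nat m"
    using b(3) by linarith+
  then have "\<bar>diff_quot h a b - y\<bar> \<le> 1 / real (Suc n)" "\<bar>diff_quot h a b - z\<bar> \<le> 1 / real (Suc n)"
    using l(2) m(2) b by blast+
  moreover have "\<bar>y - z\<bar> \<le> \<bar>diff_quot h a b - y\<bar> + \<bar>diff_quot h a b - z\<bar>"
    by linarith
  ultimately show False
    using n unfolding inverse_eq_divide by argo
qed

lemma derivative_eqI: "has_deriv_at M h a y \<Longrightarrow> derivative M h a = y"
  unfolding derivative_def by (blast intro: has_deriv_at_unique)

end

theory Submission
  imports Defs
begin

text \<open>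
  The conditions on \<open>1 / k\<close> and \<open>1 / l\<close> say that a function of the pair \<open>(a, b)\<close> tends to \<open>0\<close>
  as \<open>(a, b)\<close> approaches the diagonal off it: with \<open>a\<close> fixed for differentiability at a point,
  with \<open>a\<close> ranging over \<open>N\<close> for uniformity. The difference quotient of \<open>f g\<close> minus
  \<open>f' g + f g'\<close> at \<open>a\<close> equals
  \<open>f b * (q - g' a) + g' a * (f b - f a) + g a * (p - f' a)\<close>, where \<open>p\<close>, \<open>q\<close> are the difference
  quotients of \<open>f\<close>, \<open>g\<close> between \<open>a\<close> and \<open>b\<close>; each summand is a bounded factor times one that
  tends to \<open>0\<close>. At a fixed \<open>a\<close> the bounds come for free, so the product rule itself needs neither
  boundedness nor uniformity; these only serve the uniformity of the derivative.
\<close>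

definition at_diagonal :: "rat set \<Rightarrow> rat set \<Rightarrow> (rat \<times> rat) filter" where
  "at_diagonal N M =
    inf (filtercomap (\<lambda>p. real_of_rat (snd p - fst p)) (at 0)) (principal (N \<times> M))"

lemma at_diagonal_mono: "N \<subseteq> N' \<Longrightarrow> M \<subseteq> M' \<Longrightarrow> at_diagonal N M \<le> at_diagonal N' M'"
  unfolding at_diagonal_def by (intro inf_mono order_refl) auto

lemma abs_of_rat_diff_le_inverse_nat_iff:
  "\<bar>real_of_rat (b - a)\<bar> \<le> 1 / real l \<longleftrightarrow> \<bar>a - b\<bar> \<le> 1 / of_nat l"
proof -
  have "\<bar>real_of_rat (b - a)\<bar> = real_of_rat \<bar>a - b\<bar>"
    by (simp only: abs_of_rat abs_minus_commute)
  moreover have "1 / real l = real_of_rat (1 / of_nat l)"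
    by (simp add: of_rat_divide)
  ultimately show ?thesis
    by (simp only: of_rat_less_eq)
qed

lemma eventually_at_diagonal:
  "eventually P (at_diagonal N M) \<longleftrightarrow>
    (\<exists>l::nat. l > 0 \<and> (\<forall>a\<in>N. \<forall>b\<in>M. 0 < \<bar>a - b\<bar> \<and> \<bar>a - b\<bar> \<le> 1 / of_nat l \<longrightarrow> P (a, b)))"
    (is "_ \<longleftrightarrow> (\<exists>l. l > 0 \<and> ?near l)")
proof
  assume "eventually P (at_diagonal N M)"
  then obtain d where "d > 0"
    and P: "\<And>a b. a \<in> N \<Longrightarrow> b \<in> M \<Longrightarrow> a \<noteq> b \<Longrightarrow> \<bar>real_of_rat (b - a)\<bar> < d \<Longrightarrow> P (a, b)"
    unfolding at_diagonal_def eventually_inf_principal eventually_filtercomap eventually_at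
    by fastforce
  obtain l :: nat where "l > 0" and "1 / real l < d"
    using ex_inverse_of_nat_less[OF \<open>d > 0\<close>] by (auto simp: inverse_eq_divide)
  then have "?near l"
    using P by (fastforce simp flip: abs_of_rat_diff_le_inverse_nat_iff)
  with \<open>l > 0\<close> show "\<exists>l. l > 0 \<and> ?near l"
    by blast
next
  assume "\<exists>l. l > 0 \<and> ?near l"
  then obtain l where "l > 0" and "?near l"
    by blast
  then have "P (a, b)"
    if "a \<in> N" "b \<in> M" "a \<noteq> b" "\<bar>real_of_rat (b - a)\<bar> < 1 / real l" for a b
    using that by (simp flip: abs_of_rat_diff_le_inverse_nat_iff)
  then show "eventually P (at_diagonal N M)"
    unfolding at_diagonal_def eventually_inf_principal eventually_filtercomap eventually_at
    using \<open>l > 0\<close>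
    by (intro exI[of _ "\<lambda>x. x \<noteq> 0 \<and> \<bar>x\<bar> < 1 / real l"] conjI exI[of _ "1 / real l"]) auto
qed

lemma eventually_at_diagonal_mem:
  "\<forall>\<^sub>F p in at_diagonal N M. fst p \<in> N \<and> snd p \<in> M \<and> fst p \<noteq> snd p"
  unfolding eventually_at_diagonal by (auto intro: exI[of _ 1])

lemma tendsto_zero_iff_eventually_le_inverse_nat:
  fixes u :: "'i \<Rightarrow> 'b::real_normed_vector"
  shows "(u \<longlongrightarrow> 0) F \<longleftrightarrow> (\<forall>k::nat. k > 0 \<longrightarrow> (\<forall>\<^sub>F i in F. norm (u i) \<le> 1 / real k))"
proof
  assume "(u \<longlongrightarrow> 0) F"
  then have "\<forall>\<^sub>F i in F. norm (u i) < 1 / real k" if "k > 0" for k :: nat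
    using that unfolding tendsto_iff by simp
  then show "\<forall>k::nat. k > 0 \<longrightarrow> (\<forall>\<^sub>F i in F. norm (u i) \<le> 1 / real k)"
    by (blast intro: eventually_mono less_imp_le)
next
  assume small: "\<forall>k::nat. k > 0 \<longrightarrow> (\<forall>\<^sub>F i in F. norm (u i) \<le> 1 / real k)"
  have "\<forall>\<^sub>F i in F. norm (u i) < e" if "e > 0" for e
  proof -
    obtain k :: nat where "k > 0" and k: "inverse (real k) < e"
      using ex_inverse_of_nat_less[OF \<open>e > 0\<close>] by blast
    then have "\<forall>\<^sub>F i in F. norm (u i) \<le> 1 / real k"
      using small by blast
    then show ?thesis
      by eventually_elim (use k in \<open>simp add: inverse_eq_divide\<close>)
  qed
  then show "(u \<longlongrightarrow> 0) F"
    by (simp add: tendsto_iff)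
qed

lemma tendsto_zero_at_diagonal_iff:
  fixes u :: "rat \<times> rat \<Rightarrow> real"
  shows "(u \<longlongrightarrow> 0) (at_diagonal N M) \<longleftrightarrow>
    (\<forall>k::nat. k > 0 \<longrightarrow> (\<exists>l::nat. l > 0 \<and>
      (\<forall>a\<in>N. \<forall>b\<in>M. 0 < \<bar>a - b\<bar> \<and> \<bar>a - b\<bar> \<le> 1 / of_nat l \<longrightarrow> \<bar>u (a, b)\<bar> \<le> 1 / real k)))"
  unfolding tendsto_zero_iff_eventually_le_inverse_nat eventually_at_diagonal real_norm_def ..

lemma tendsto_increment_at_diagonal:
  "((\<lambda>p. real_of_rat (snd p - fst p)) \<longlongrightarrow> 0) (at_diagonal N M)"
proof -
  have "filterlim (\<lambda>p. real_of_rat (snd p - fst p)) (at 0) (at_diagonal N M)"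
    unfolding at_diagonal_def by (rule filterlim_mono[OF filterlim_filtercomap order_refl inf_le1])
  then show ?thesis
    by (simp add: filterlim_at)
qed

lemma unif_cont_on_imp_tendsto:
  assumes "unif_cont_on M h" and "N \<subseteq> M"
  shows "((\<lambda>p. h (snd p) - h (fst p)) \<longlongrightarrow> 0) (at_diagonal N M)"
proof -
  have "((\<lambda>p. h (snd p) - h (fst p)) \<longlongrightarrow> 0) (at_diagonal M M)"
    using assms(1) unfolding unif_cont_on_def tendsto_zero_at_diagonal_iff
    by (metis abs_minus_commute fst_conv snd_conv)
  then show ?thesis
    using at_diagonal_mono[OF \<open>N \<subseteq> M\<close> order_refl] by (rule tendsto_mono[rotated])
qed

lemma has_deriv_at_iff_tendsto:
  "has_deriv_at M h a y \<longleftrightarrow> a \<in> M \<and> limit_point M a \<and>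
    ((\<lambda>p. diff_quot h a (snd p) - y) \<longlongrightarrow> 0) (at_diagonal {a} M)"
  unfolding has_deriv_at_def tendsto_zero_at_diagonal_iff by simp

lemma uniform_derivative_on_iff_tendsto:
  "uniform_derivative_on M h N \<longleftrightarrow> N \<subseteq> diff_dom M h \<and>
    ((\<lambda>p. diff_quot h (fst p) (snd p) - derivative M h (fst p)) \<longlongrightarrow> 0) (at_diagonal N M)"
  unfolding uniform_derivative_on_def tendsto_zero_at_diagonal_iff by simp

lemma diff_domI: "has_deriv_at M h a y \<Longrightarrow> a \<in> diff_dom M h"
  unfolding diff_dom_def by blast

lemma has_deriv_at_derivative: "a \<in> diff_dom M h \<Longrightarrow> has_deriv_at M h a (derivative M h a)"
  unfolding diff_dom_def using derivative_eqI by blast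

lemma diff_dom_subset: "diff_dom M h \<subseteq> M"
  unfolding diff_dom_def has_deriv_at_def by blast

lemma uniform_derivative_on_imp_subset: "uniform_derivative_on M h N \<Longrightarrow> N \<subseteq> diff_dom M h"
  unfolding uniform_derivative_on_def by blast

lemma uniform_derivative_on_subset:
  assumes "uniform_derivative_on M h N" and "N' \<subseteq> N"
  shows "uniform_derivative_on M h N'"
  using assms unfolding uniform_derivative_on_def by (meson subset_iff)

lemma has_deriv_at_imp_tendsto:
  assumes "has_deriv_at M h a y"
  shows "((\<lambda>p. h (snd p)) \<longlongrightarrow> h a) (at_diagonal {a} M)"
proof -
  have "((\<lambda>p. diff_quot h a (snd p)) \<longlongrightarrow> y) (at_diagonal {a} M)"
    using assms unfolding has_deriv_at_iff_tendsto by (simp add: LIM_zero_iff)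
  then have "((\<lambda>p. h a + diff_quot h a (snd p) * real_of_rat (snd p - fst p)) \<longlongrightarrow> h a + y * 0)
      (at_diagonal {a} M)"
    by (intro tendsto_intros tendsto_increment_at_diagonal)
  moreover have "\<forall>\<^sub>F p in at_diagonal {a} M.
      h a + diff_quot h a (snd p) * real_of_rat (snd p - fst p) = h (snd p)"
    using eventually_at_diagonal_mem by eventually_elim (auto simp: diff_quot_def)
  ultimately show ?thesis
    by (simp add: filterlim_cong)
qed

lemma diff_quot_mult:
  "diff_quot (\<lambda>x. f x * g x) a b - (f' * g a + f a * g') =
    f b * (diff_quot g a b - g') + g' * (f b - f a) + g a * (diff_quot f a b - f')"
proof -
  have "f b * g b - f a * g a = f b * (g b - g a) + g a * (f b - f a)"
    by (simp add: algebra_simps)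
  then have "diff_quot (\<lambda>x. f x * g x) a b = f b * diff_quot g a b + g a * diff_quot f a b"
    unfolding diff_quot_def by (simp add: add_divide_distrib)
  then show ?thesis
    by (simp add: algebra_simps)
qed

lemma tendsto_diff_quot_mult:
  fixes a b :: "'i \<Rightarrow> rat"
  assumes "((\<lambda>i. diff_quot f (a i) (b i) - f' i) \<longlongrightarrow> 0) F"
    and "((\<lambda>i. diff_quot g (a i) (b i) - g' i) \<longlongrightarrow> 0) F"
    and "((\<lambda>i. f (b i) - f (a i)) \<longlongrightarrow> 0) F"
    and "Bfun (\<lambda>i. f (b i)) F" and "Bfun (\<lambda>i. g (a i)) F" and "Bfun g' F"
  shows "((\<lambda>i. diff_quot (\<lambda>x. f x * g x) (a i) (b i) - (f' i * g (a i) + f (a i) * g' i)) \<longlongrightarrow> 0) F"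
proof -
  have bounded_mult_null: "((\<lambda>i. u i * v i) \<longlongrightarrow> 0) F" if "Bfun u F" "(v \<longlongrightarrow> 0) F"
    for u v :: "'i \<Rightarrow> real"
    using bounded_bilinear.Bfun_prod_Zfun[OF bounded_bilinear_mult] that
    by (simp add: tendsto_Zfun_iff)
  show ?thesis
    unfolding diff_quot_mult using assms by (intro tendsto_add_zero bounded_mult_null)
qed

lemma tendsto_imp_Bfun:
  fixes u :: "'i \<Rightarrow> 'b::metric_space"
  assumes "(u \<longlongrightarrow> l) F"
  shows "Bfun u F"
proof -
  have "\<forall>\<^sub>F i in F. dist (u i) l < 1"
    using assms by (rule tendstoD) simp
  then have "\<forall>\<^sub>F i in F. dist (u i) l \<le> 1"
    by (rule eventually_mono) simp
  then show ?thesis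
    unfolding Bfun_metric_def using zero_less_one by blast
qed

lemma has_deriv_at_mult:
  assumes f: "has_deriv_at M f a f'" and g: "has_deriv_at M g a g'"
  shows "has_deriv_at M (\<lambda>x. f x * g x) a (f' * g a + f a * g')"
proof -
  have f_lim: "((\<lambda>p. f (snd p)) \<longlongrightarrow> f a) (at_diagonal {a} M)"
    using f by (rule has_deriv_at_imp_tendsto)
  have "((\<lambda>p. diff_quot (\<lambda>x. f x * g x) a (snd p) - (f' * g a + f a * g')) \<longlongrightarrow> 0)
      (at_diagonal {a} M)"
  proof (rule tendsto_diff_quot_mult)
    show "((\<lambda>p. diff_quot f a (snd p) - f') \<longlongrightarrow> 0) (at_diagonal {a} M)"
      and "((\<lambda>p. diff_quot g a (snd p) - g') \<longlongrightarrow> 0) (at_diagonal {a} M)"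
      using f g by (simp_all add: has_deriv_at_iff_tendsto)
  qed (use f_lim in \<open>simp_all add: LIM_zero tendsto_imp_Bfun\<close>)
  then show ?thesis
    using f by (simp add: has_deriv_at_iff_tendsto)
qed

lemma bounded_image_imp_Bfun:
  fixes h :: "'a \<Rightarrow> 'b::real_normed_vector"
  assumes "bounded (h ` S)" and "\<forall>\<^sub>F i in F. c i \<in> S"
  shows "Bfun (\<lambda>i. h (c i)) F"
proof -
  obtain B where "\<forall>x\<in>S. norm (h x) \<le> B"
    using assms(1) unfolding bounded_iff by blast
  then show ?thesis
    using assms(2) by (intro BfunI[of _ B]) (blast intro: eventually_mono)
qed

lemma uniform_derivative_on_mult:
  assumes f: "uniform_derivative_on M f N" and g: "uniform_derivative_on M g N"
    and cont: "unif_cont_on M f"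
    and bounded: "bounded (f ` M)" "bounded (g ` N)" "bounded (derivative M g ` N)"
  shows "uniform_derivative_on M (\<lambda>x. f x * g x) N"
proof -
  let ?D = "\<lambda>a. derivative M f a * g a + f a * derivative M g a"
  let ?quot = "\<lambda>p. diff_quot (\<lambda>x. f x * g x) (fst p) (snd p)"
  have deriv: "has_deriv_at M (\<lambda>x. f x * g x) a (?D a)" if "a \<in> N" for a
    using uniform_derivative_on_imp_subset[OF f] uniform_derivative_on_imp_subset[OF g] that
    by (intro has_deriv_at_mult has_deriv_at_derivative) auto
  have "N \<subseteq> M"
    using uniform_derivative_on_imp_subset[OF f] diff_dom_subset by (rule subset_trans)
  have mem: "\<forall>\<^sub>F p in at_diagonal N M. fst p \<in> N" "\<forall>\<^sub>F p in at_diagonal N M. snd p \<in> M"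
    by (rule eventually_mono[OF eventually_at_diagonal_mem], simp)+
  have "((\<lambda>p. ?quot p - ?D (fst p)) \<longlongrightarrow> 0) (at_diagonal N M)"
  proof (rule tendsto_diff_quot_mult)
    show "((\<lambda>p. diff_quot f (fst p) (snd p) - derivative M f (fst p)) \<longlongrightarrow> 0) (at_diagonal N M)"
      and "((\<lambda>p. diff_quot g (fst p) (snd p) - derivative M g (fst p)) \<longlongrightarrow> 0) (at_diagonal N M)"
      using f g by (simp_all add: uniform_derivative_on_iff_tendsto)
    show "((\<lambda>p. f (snd p) - f (fst p)) \<longlongrightarrow> 0) (at_diagonal N M)"
      using cont \<open>N \<subseteq> M\<close> by (rule unif_cont_on_imp_tendsto)
    show "Bfun (\<lambda>p. f (snd p)) (at_diagonal N M)"
      using bounded(1) mem(2) by (rule bounded_image_imp_Bfun)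
    show "Bfun (\<lambda>p. g (fst p)) (at_diagonal N M)"
      using bounded(2) mem(1) by (rule bounded_image_imp_Bfun)
    show "Bfun (\<lambda>p. derivative M g (fst p)) (at_diagonal N M)"
      using bounded(3) mem(1) by (rule bounded_image_imp_Bfun)
  qed
  moreover have "\<forall>\<^sub>F p in at_diagonal N M.
      ?quot p - ?D (fst p) = ?quot p - derivative M (\<lambda>x. f x * g x) (fst p)"
    using mem(1) by eventually_elim (simp add: derivative_eqI[OF deriv])
  ultimately have "((\<lambda>p. ?quot p - derivative M (\<lambda>x. f x * g x) (fst p)) \<longlongrightarrow> 0)
      (at_diagonal N M)"
    by (rule Lim_transform_eventually)
  then show ?thesis
    unfolding uniform_derivative_on_iff_tendsto using deriv by (blast intro: diff_domI)
qed

theorem theorem2p42: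
  fixes M :: "rat set" and f g :: "rat \<Rightarrow> real"
  assumes "bounded (f ` M)" and "bounded (g ` M)"
    and "unif_cont_on M f \<and> bounded (derivative M g ` diff_dom M g) \<or>
         unif_cont_on M g \<and> bounded (derivative M f ` diff_dom M f)"
    and "uniform_derivative_on M f (diff_dom M f)"
    and "uniform_derivative_on M g (diff_dom M g)"
  shows "diff_dom M f \<inter> diff_dom M g \<subseteq> diff_dom M (\<lambda>x. f x * g x) \<and>
    (\<forall>a \<in> diff_dom M f \<inter> diff_dom M g.
      derivative M (\<lambda>x. f x * g x) a = derivative M f a * g a + f a * derivative M g a) \<and>
    uniform_derivative_on M (\<lambda>x. f x * g x) (diff_dom M f \<inter> diff_dom M g)"
proof (intro conjI subsetI ballI)
  let ?N = "diff_dom M f \<inter> diff_dom M g"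
  have deriv: "has_deriv_at M (\<lambda>x. f x * g x) a (derivative M f a * g a + f a * derivative M g a)"
    if "a \<in> ?N" for a
    using that by (intro has_deriv_at_mult has_deriv_at_derivative) auto
  show "a \<in> diff_dom M (\<lambda>x. f x * g x)"
    and "derivative M (\<lambda>x. f x * g x) a = derivative M f a * g a + f a * derivative M g a"
    if "a \<in> ?N" for a
    using deriv[OF that] by (rule diff_domI, rule derivative_eqI)
  have uniform: "uniform_derivative_on M f ?N" "uniform_derivative_on M g ?N"
    using assms(4,5) by (auto intro: uniform_derivative_on_subset)
  have bounded: "bounded (f ` ?N)" "bounded (g ` ?N)"
    using assms(1,2) diff_dom_subset by (blast intro: bounded_subset)+
  from assms(3) show "uniform_derivative_on M (\<lambda>x. f x * g x) ?N"
  proof (elim disjE conjE)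
    assume "unif_cont_on M f" and "bounded (derivative M g ` diff_dom M g)"
    then show ?thesis
      by (intro uniform_derivative_on_mult uniform assms(1) bounded) (auto intro: bounded_subset)
  next
    assume "unif_cont_on M g" and "bounded (derivative M f ` diff_dom M f)"
    then have "uniform_derivative_on M (\<lambda>x. g x * f x) ?N"
      by (intro uniform_derivative_on_mult uniform assms(2) bounded) (auto intro: bounded_subset)
    then show ?thesis
      by (simp only: mult.commute)
  qed
qed

end
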